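(* For any variable $x$, the equation $\{x\mid\bot\}=\varnothing$ is derivable.
   Context: Formal system. Objects are generated from the constant $\varnothing$ by: $(\alpha)^{\mathsf c}$, $(\alpha)^{\mathsf v}$ (variables are objects of this form), $(\alpha\,\&\,\beta)$ (federation), $(\alpha\Rightarrow\beta)$ (containment/implication), $(\alpha\cap\beta)$, and classes $\{x\mid\beta\}$ ($x$ a variable, which becomes a bound index). $\alpha[x:=\beta]$ replaces every free appearance of $x$ by $\beta$. Abbreviations: $\bot:=\varnothing^{\mathsf c}$; $\neg a:=(a\Rightarrow\bot)$; $\bar a:=(\varnothing\Rightarrow a)$; $a\vee b:=\overline{\bar a\cap\bar b}$; $a=b:=(a\Rightarrow b)\&(b\Rightarrow a)$; $a\neq b:=\neg(a=b)$; $\mathrm{Sing}(a):=(\bar a\neq a)\,\&\,((a\Rightarrow b)\Rightarrow(\bar b\vee a=b))$, with $b$ a variable; $a\in b:=\mathrm{Sing}(a)\&(b\Rightarrow a)$; $V:=\{x\mid\varnothing\}$. Rules: R1 from $\alpha$ and $\alpha\Rightarrow\beta$ infer $\beta$; R2 from $\alpha$ infer $\alpha[x:=\beta]$; R3 if $x$ does not appear in $\gamma$, from $\gamma\Rightarrow(\alpha\Rightarrow\beta)$ infer $\gamma\Rightarrow(\{x\mid\beta\}\Rightarrow\{x\mid\alpha\})$. Axioms ($a,b,c,d,x$ variables): A1 $((c\Rightarrow a)\&(c\Rightarrow(a\Rightarrow b)))\Rightarrow(c\Rightarrow b)$; A2 $((d\Rightarrow(a\Rightarrow b))\&(d\Rightarrow(b\Rightarrow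 c)))\Rightarrow(d\Rightarrow(a\Rightarrow c))$; A3 $((c\Rightarrow a)\&(c\Rightarrow b))\Rightarrow(c\Rightarrow(a\&b))$; A4 $(a\&b)\Rightarrow a$, $(a\&b)\Rightarrow b$; A5 $a\Rightarrow(a\cap b)$, $b\Rightarrow(a\cap b)$; A6 $((a\Rightarrow c)\&(b\Rightarrow c))\Rightarrow((a\cap b)\Rightarrow c)$; A7 $a\Rightarrow a$; A8 $a\Rightarrow\varnothing$; A9 $\bot\Rightarrow a$; A10 $(\varnothing\Rightarrow a)\Rightarrow((\varnothing\Rightarrow b)\Rightarrow(a\&b))$; A11 $(a\Rightarrow b)\Rightarrow(\varnothing\Rightarrow(a\Rightarrow b))$; A12 $(((a\Rightarrow b)\Rightarrow\bot)\Rightarrow\bot)\Rightarrow(a\Rightarrow b)$; A13 (schema) $a\in\{x\mid\alpha\}=(\mathrm{Sing}(a)\&\alpha[x:=a])$; A14a $a\Rightarrow\{x\mid x\in a\}$; A14b $(V\Rightarrow a)\Rightarrow(\{x\mid x\in a\}\Rightarrow a)$. *)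

theory Defs
  imports Main
begin

text \<open>
  Raw expressions. \<open>Con \<alpha>\<close> is \<open>\<alpha>\<^sup>c\<close> and \<open>Var \<alpha>\<close> is the variable \<open>\<alpha>\<^sup>v\<close>. In \<open>{x | \<beta>}\<close> the
  variable \<open>x\<close> becomes a bound index: the class is stored as \<open>Cls \<beta>'\<close>, where \<open>\<beta>'\<close> has the de
  Bruijn index of this binder in place of \<open>x\<close>. The objects of the system are singled out by the
  predicate \<open>object\<close> below; they have no dangling indices.
\<close>

datatype expr =
    Nought  ("\<^bold>\<emptyset>")
  | Con expr
  | Var expr
  | Fed expr expr  (infixr "\<^bold>&" 70)
  | Imp expr expr  (infixr "\<^bold>\<Rightarrow>" 60)
  | Cap expr expr  (infixr "\<^bold>\<inter>" 75)
  | Idx nat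
  | Cls expr

text \<open>
  A variable \<open>\<alpha>\<^sup>v\<close> is atomic: \<open>\<alpha>\<close> only serves as its name, and variables inside \<open>\<alpha>\<close> do not count
  as appearing in \<open>\<alpha>\<^sup>v\<close>. If they did, \<open>{x | x\<^sup>v}\<close> would make a bound index part of
  a variable, which could then be substituted away.
\<close>

primrec bind :: "expr \<Rightarrow> nat \<Rightarrow> expr \<Rightarrow> expr" where
  "bind x k \<^bold>\<emptyset> = \<^bold>\<emptyset>"
| "bind x k (Con \<alpha>) = Con (bind x k \<alpha>)"
| "bind x k (Var \<alpha>) = (if Var \<alpha> = x then Idx k else Var \<alpha>)"
| "bind x k (\<alpha> \<^bold>& \<beta>) = bind x k \<alpha> \<^bold>& bind x k \<beta>"
| "bind x k (\<alpha> \<^bold>\<Rightarrow> \<beta>) = (bind x k \<alpha> \<^bold>\<Rightarrow> bind x k \<beta>)"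
| "bind x k (\<alpha> \<^bold>\<inter> \<beta>) = bind x k \<alpha> \<^bold>\<inter> bind x k \<beta>"
| "bind x k (Idx i) = Idx i"
| "bind x k (Cls \<alpha>) = Cls (bind x (Suc k) \<alpha>)"

definition cls :: "expr \<Rightarrow> expr \<Rightarrow> expr"  ("\<lbrace>_ \<^bold>| _\<rbrace>") where
  "\<lbrace>x \<^bold>| \<beta>\<rbrace> = Cls (bind x 0 \<beta>)"

inductive object :: "expr \<Rightarrow> bool" where
  "object \<^bold>\<emptyset>"
| "object \<alpha> \<Longrightarrow> object (Con \<alpha>)"
| "object \<alpha> \<Longrightarrow> object (Var \<alpha>)"
| "object \<alpha> \<Longrightarrow> object \<beta> \<Longrightarrow> object (\<alpha> \<^bold>& \<beta>)"
| "object \<alpha> \<Longrightarrow> object \<beta> \<Longrightarrow> object (\<alpha> \<^bold>\<Rightarrow> \<beta>)"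
| "object \<alpha> \<Longrightarrow> object \<beta> \<Longrightarrow> object (\<alpha> \<^bold>\<inter> \<beta>)"
| "object (Var \<alpha>) \<Longrightarrow> object \<beta> \<Longrightarrow> object \<lbrace>Var \<alpha> \<^bold>| \<beta>\<rbrace>"

definition variable :: "expr \<Rightarrow> bool" where
  "variable x \<longleftrightarrow> (\<exists>\<alpha>. object \<alpha> \<and> x = Var \<alpha>)"

text \<open>No capture can occur here, since the substituted \<open>\<beta>\<close> is an object.\<close>

primrec subst :: "expr \<Rightarrow> expr \<Rightarrow> expr \<Rightarrow> expr"  ("_[_ \<^bold>:= _]" [1000, 51, 51] 1000) where
  "\<^bold>\<emptyset>[x \<^bold>:= \<beta>] = \<^bold>\<emptyset>"
| "(Con \<alpha>)[x \<^bold>:= \<beta>] = Con (\<alpha>[x \<^bold>:= \<beta>])"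
| "(Var \<alpha>)[x \<^bold>:= \<beta>] = (if Var \<alpha> = x then \<beta> else Var \<alpha>)"
| "(\<alpha> \<^bold>& \<gamma>)[x \<^bold>:= \<beta>] = \<alpha>[x \<^bold>:= \<beta>] \<^bold>& \<gamma>[x \<^bold>:= \<beta>]"
| "(\<alpha> \<^bold>\<Rightarrow> \<gamma>)[x \<^bold>:= \<beta>] = (\<alpha>[x \<^bold>:= \<beta>] \<^bold>\<Rightarrow> \<gamma>[x \<^bold>:= \<beta>])"
| "(\<alpha> \<^bold>\<inter> \<gamma>)[x \<^bold>:= \<beta>] = \<alpha>[x \<^bold>:= \<beta>] \<^bold>\<inter> \<gamma>[x \<^bold>:= \<beta>]"
| "(Idx i)[x \<^bold>:= \<beta>] = Idx i"
| "(Cls \<alpha>)[x \<^bold>:= \<beta>] = Cls (\<alpha>[x \<^bold>:= \<beta>])"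

primrec appears :: "expr \<Rightarrow> expr \<Rightarrow> bool" where
  "appears x \<^bold>\<emptyset> \<longleftrightarrow> False"
| "appears x (Con \<alpha>) \<longleftrightarrow> appears x \<alpha>"
| "appears x (Var \<alpha>) \<longleftrightarrow> Var \<alpha> = x"
| "appears x (\<alpha> \<^bold>& \<beta>) \<longleftrightarrow> appears x \<alpha> \<or> appears x \<beta>"
| "appears x (\<alpha> \<^bold>\<Rightarrow> \<beta>) \<longleftrightarrow> appears x \<alpha> \<or> appears x \<beta>"
| "appears x (\<alpha> \<^bold>\<inter> \<beta>) \<longleftrightarrow> appears x \<alpha> \<or> appears x \<beta>"
| "appears x (Idx i) \<longleftrightarrow> False"
| "appears x (Cls \<alpha>) \<longleftrightarrow> appears x \<alpha>"

abbreviation Bot :: expr  ("\<^bold>\<bottom>") where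
  "\<^bold>\<bottom> \<equiv> Con \<^bold>\<emptyset>"

abbreviation Neg :: "expr \<Rightarrow> expr"  ("\<^bold>\<not> _" [80] 80) where
  "\<^bold>\<not> \<alpha> \<equiv> (\<alpha> \<^bold>\<Rightarrow> \<^bold>\<bottom>)"

abbreviation Over :: "expr \<Rightarrow> expr" where
  "Over \<alpha> \<equiv> (\<^bold>\<emptyset> \<^bold>\<Rightarrow> \<alpha>)"

abbreviation Or :: "expr \<Rightarrow> expr \<Rightarrow> expr"  (infixr "\<^bold>\<or>" 65) where
  "\<alpha> \<^bold>\<or> \<beta> \<equiv> Over (Over \<alpha> \<^bold>\<inter> Over \<beta>)"

abbreviation Eq :: "expr \<Rightarrow> expr \<Rightarrow> expr"  (infix "\<^bold>=" 55) where
  "\<alpha> \<^bold>= \<beta> \<equiv> (\<alpha> \<^bold>\<Rightarrow> \<beta>) \<^bold>& (\<beta> \<^bold>\<Rightarrow> \<alpha>)"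

text \<open>
  The free variable \<open>b\<close> in \<open>Sing(\<alpha>)\<close>, hence also in \<open>\<alpha> \<in> \<beta>\<close>, is an explicit first
  argument.
\<close>

abbreviation Sing :: "expr \<Rightarrow> expr \<Rightarrow> expr" where
  "Sing b \<alpha> \<equiv> \<^bold>\<not> (Over \<alpha> \<^bold>= \<alpha>) \<^bold>& ((\<alpha> \<^bold>\<Rightarrow> b) \<^bold>\<Rightarrow> (Over b \<^bold>\<or> (\<alpha> \<^bold>= b)))"

abbreviation Mem :: "expr \<Rightarrow> expr \<Rightarrow> expr \<Rightarrow> expr" where
  "Mem b \<alpha> \<beta> \<equiv> Sing b \<alpha> \<^bold>& (\<beta> \<^bold>\<Rightarrow> \<alpha>)"

text \<open>The index of \<open>V = {x | \<emptyset>}\<close> is immaterial, as \<open>x\<close> does not appear in \<open>\<emptyset>\<close>.\<close>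

abbreviation V :: expr where
  "V \<equiv> \<lbrace>Var \<^bold>\<emptyset> \<^bold>| \<^bold>\<emptyset>\<rbrace>"

definition variables :: "expr list \<Rightarrow> bool" where
  "variables xs \<longleftrightarrow> distinct xs \<and> (\<forall>x \<in> set xs. variable x)"

inductive derivable :: "expr \<Rightarrow> bool"  ("\<^bold>\<turnstile> _" [50] 50) where
  R1: "\<^bold>\<turnstile> \<alpha> \<Longrightarrow> \<^bold>\<turnstile> (\<alpha> \<^bold>\<Rightarrow> \<beta>) \<Longrightarrow> \<^bold>\<turnstile> \<beta>"
| R2: "\<^bold>\<turnstile> \<alpha> \<Longrightarrow> variable x \<Longrightarrow> object \<beta> \<Longrightarrow> \<^bold>\<turnstile> \<alpha>[x \<^bold>:= \<beta>]"
| R3: "\<^bold>\<turnstile> (\<gamma> \<^bold>\<Rightarrow> (\<alpha> \<^bold>\<Rightarrow> \<beta>)) \<Longrightarrow> variable x \<Longrightarrow> object \<alpha> \<Longrightarrow> object \<beta> \<Longrightarrow> object \<gamma> \<Longrightarrow>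
       \<not> appears x \<gamma> \<Longrightarrow> \<^bold>\<turnstile> (\<gamma> \<^bold>\<Rightarrow> (\<lbrace>x \<^bold>| \<beta>\<rbrace> \<^bold>\<Rightarrow> \<lbrace>x \<^bold>| \<alpha>\<rbrace>))"
| A1: "variables [a, b, c] \<Longrightarrow>
       \<^bold>\<turnstile> (((c \<^bold>\<Rightarrow> a) \<^bold>& (c \<^bold>\<Rightarrow> (a \<^bold>\<Rightarrow> b))) \<^bold>\<Rightarrow> (c \<^bold>\<Rightarrow> b))"
| A2: "variables [a, b, c, d] \<Longrightarrow>
       \<^bold>\<turnstile> (((d \<^bold>\<Rightarrow> (a \<^bold>\<Rightarrow> b)) \<^bold>& (d \<^bold>\<Rightarrow> (b \<^bold>\<Rightarrow> c))) \<^bold>\<Rightarrow> (d \<^bold>\<Rightarrow> (a \<^bold>\<Rightarrow> c)))"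
| A3: "variables [a, b, c] \<Longrightarrow>
       \<^bold>\<turnstile> (((c \<^bold>\<Rightarrow> a) \<^bold>& (c \<^bold>\<Rightarrow> b)) \<^bold>\<Rightarrow> (c \<^bold>\<Rightarrow> (a \<^bold>& b)))"
| A4_left: "variables [a, b] \<Longrightarrow> \<^bold>\<turnstile> ((a \<^bold>& b) \<^bold>\<Rightarrow> a)"
| A4_right: "variables [a, b] \<Longrightarrow> \<^bold>\<turnstile> ((a \<^bold>& b) \<^bold>\<Rightarrow> b)"
| A5_left: "variables [a, b] \<Longrightarrow> \<^bold>\<turnstile> (a \<^bold>\<Rightarrow> (a \<^bold>\<inter> b))"
| A5_right: "variables [a, b] \<Longrightarrow> \<^bold>\<turnstile> (b \<^bold>\<Rightarrow> (a \<^bold>\<inter> b))"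
| A6: "variables [a, b, c] \<Longrightarrow>
       \<^bold>\<turnstile> (((a \<^bold>\<Rightarrow> c) \<^bold>& (b \<^bold>\<Rightarrow> c)) \<^bold>\<Rightarrow> ((a \<^bold>\<inter> b) \<^bold>\<Rightarrow> c))"
| A7: "variable a \<Longrightarrow> \<^bold>\<turnstile> (a \<^bold>\<Rightarrow> a)"
| A8: "variable a \<Longrightarrow> \<^bold>\<turnstile> (a \<^bold>\<Rightarrow> \<^bold>\<emptyset>)"
| A9: "variable a \<Longrightarrow> \<^bold>\<turnstile> (\<^bold>\<bottom> \<^bold>\<Rightarrow> a)"
| A10: "variables [a, b] \<Longrightarrow> \<^bold>\<turnstile> ((\<^bold>\<emptyset> \<^bold>\<Rightarrow> a) \<^bold>\<Rightarrow> ((\<^bold>\<emptyset> \<^bold>\<Rightarrow> b) \<^bold>\<Rightarrow> (a \<^bold>& b)))"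
| A11: "variables [a, b] \<Longrightarrow> \<^bold>\<turnstile> ((a \<^bold>\<Rightarrow> b) \<^bold>\<Rightarrow> (\<^bold>\<emptyset> \<^bold>\<Rightarrow> (a \<^bold>\<Rightarrow> b)))"
| A12: "variables [a, b] \<Longrightarrow> \<^bold>\<turnstile> ((((a \<^bold>\<Rightarrow> b) \<^bold>\<Rightarrow> \<^bold>\<bottom>) \<^bold>\<Rightarrow> \<^bold>\<bottom>) \<^bold>\<Rightarrow> (a \<^bold>\<Rightarrow> b))"
| A13: "variables [a, b, x] \<Longrightarrow> object \<alpha> \<Longrightarrow>
       \<^bold>\<turnstile> (Mem b a \<lbrace>x \<^bold>| \<alpha>\<rbrace> \<^bold>= (Sing b a \<^bold>& \<alpha>[x \<^bold>:= a]))"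
| A14a: "variables [a, b, x] \<Longrightarrow> \<^bold>\<turnstile> (a \<^bold>\<Rightarrow> \<lbrace>x \<^bold>| Mem b x a\<rbrace>)"
| A14b: "variables [a, b, x] \<Longrightarrow> \<^bold>\<turnstile> ((V \<^bold>\<Rightarrow> a) \<^bold>\<Rightarrow> (\<lbrace>x \<^bold>| Mem b x a\<rbrace> \<^bold>\<Rightarrow> a))"

end

theory Submission
  imports Defs
begin

text \<open>
  Since \<open>\<Rightarrow>\<close> is reverse containment, \<open>\<emptyset> \<Rightarrow> {x | \<bottom>}\<close> is the non-trivial half of the equation. A14a at
  \<open>a = \<emptyset>\<close> gives \<open>\<emptyset> \<Rightarrow> {x | x \<in> \<emptyset>}\<close>, and as R3 reverses implications, \<open>\<bottom> \<Rightarrow> x \<in> \<emptyset>\<close> (an instance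
  of A9) yields \<open>{x | x \<in> \<emptyset>} \<Rightarrow> {x | \<bottom>}\<close>.
\<close>

lemma variable_imp_object: "variable x \<Longrightarrow> object x"
  by (auto simp: variable_def intro: object.intros)

lemma object_cls: "variable x \<Longrightarrow> object \<beta> \<Longrightarrow> object \<lbrace>x \<^bold>| \<beta>\<rbrace>"
  by (auto simp: variable_def intro: object.intros)

lemma appears_variable: "variable y \<Longrightarrow> appears x y \<longleftrightarrow> y = x"
  by (auto simp: variable_def)

lemma subst_not_appears: "\<not> appears x \<alpha> \<Longrightarrow> \<alpha>[x \<^bold>:= \<beta>] = \<alpha>"
  by (induction \<alpha>) auto

lemma subst_variable: "variable y \<Longrightarrow> y[x \<^bold>:= \<beta>] = (if y = x then \<beta> else y)"
  by (auto simp: variable_def)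

lemma bind_variable: "variable y \<Longrightarrow> bind x k y = (if y = x then Idx k else y)"
  by (auto simp: variable_def)

lemma finite_appears: "finite {x. appears x \<alpha>}"
  by (induction \<alpha>) simp_all

text \<open>Iterating \<open>Con\<close> on \<emptyset> yields infinitely many objects, told apart
  by their size, and each of them names a variable.\<close>

lemma infinite_variables: "infinite {x. variable x}"
proof -
  have object: "object ((Con ^^ n) \<^bold>\<emptyset>)" for n
    by (induction n) (auto intro: object.intros)
  have "inj (\<lambda>n. Var ((Con ^^ n) \<^bold>\<emptyset>))"
  proof (rule injI)
    fix m n assume "Var ((Con ^^ m) \<^bold>\<emptyset>) = Var ((Con ^^ n) \<^bold>\<emptyset>)"
    then have "size ((Con ^^ m) \<^bold>\<emptyset>) = size ((Con ^^ n) \<^bold>\<emptyset>)"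
      by simp
    moreover have "size ((Con ^^ k) \<^bold>\<emptyset>) = k" for k
      by (induction k) simp_all
    ultimately show "m = n" by simp
  qed
  moreover have "range (\<lambda>n. Var ((Con ^^ n) \<^bold>\<emptyset>)) \<subseteq> {x. variable x}"
    using object by (auto simp: variable_def)
  ultimately show ?thesis
    by (meson finite_imageD finite_subset infinite_UNIV_nat)
qed

text \<open>Only finitely many variables appear in a finite set of expressions, while there are
  infinitely many variables.\<close>

lemma fresh_variable:
  assumes "finite E"
  obtains x where "variable x" "\<forall>\<alpha>\<in>E. \<not> appears x \<alpha>"
proof -
  have "finite (\<Union>\<alpha>\<in>E. {x. appears x \<alpha>})"
    using assms finite_appears by blast
  then obtain x where "x \<in> {x. variable x} - (\<Union>\<alpha>\<in>E. {x. appears x \<alpha>})"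
    using infinite_variables by (metis Diff_infinite_finite ex_in_conv finite.emptyI)
  then show ?thesis using that by blast
qed

text \<open>The axioms speak of variables only; R2 lifts them to arbitrary objects. With one
  variable to replace, any choice of it will do.\<close>

lemma derivable_A8:
  assumes "object \<alpha>"
  shows "\<^bold>\<turnstile> (\<alpha> \<^bold>\<Rightarrow> \<^bold>\<emptyset>)"
proof -
  obtain a where a: "variable a" using fresh_variable[of "{}"] by blast
  show ?thesis using R2[OF A8[OF a] a assms] a by (simp add: subst_variable)
qed

lemma derivable_A9:
  assumes "object \<alpha>"
  shows "\<^bold>\<turnstile> (\<^bold>\<bottom> \<^bold>\<Rightarrow> \<alpha>)"
proof -
  obtain a where a: "variable a" using fresh_variable[of "{}"] by blast
  show ?thesis using R2[OF A9[OF a] a assms] a by (simp add: subst_variable)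
qed

text \<open>
  R2 substitutes one variable at a time, so each later variable is chosen not to appear in
  the objects already substituted.
\<close>

lemma derivable_A10:
  assumes "object \<alpha>" "object \<beta>"
  shows "\<^bold>\<turnstile> (Over \<alpha> \<^bold>\<Rightarrow> (Over \<beta> \<^bold>\<Rightarrow> (\<alpha> \<^bold>& \<beta>)))"
proof -
  obtain a where a: "variable a" using fresh_variable[of "{}"] by blast
  obtain b where b: "variable b" "\<not> appears b a" "\<not> appears b \<alpha>"
    using fresh_variable[of "{a, \<alpha>}"] by auto
  have ab: "a \<noteq> b" using a b by (auto simp: appears_variable)
  have "variables [a, b]" using a b ab by (simp add: variables_def)
  from R2[OF R2[OF A10[OF this] a assms(1)] b(1) assms(2)] show ?thesis
    using a b ab by (simp add: subst_variable subst_not_appears)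
qed

lemma derivable_A11:
  assumes "object \<alpha>" "object \<beta>"
  shows "\<^bold>\<turnstile> ((\<alpha> \<^bold>\<Rightarrow> \<beta>) \<^bold>\<Rightarrow> Over (\<alpha> \<^bold>\<Rightarrow> \<beta>))"
proof -
  obtain a where a: "variable a" using fresh_variable[of "{}"] by blast
  obtain b where b: "variable b" "\<not> appears b a" "\<not> appears b \<alpha>"
    using fresh_variable[of "{a, \<alpha>}"] by auto
  have ab: "a \<noteq> b" using a b by (auto simp: appears_variable)
  have "variables [a, b]" using a b ab by (simp add: variables_def)
  from R2[OF R2[OF A11[OF this] a assms(1)] b(1) assms(2)] show ?thesis
    using a b ab by (simp add: subst_variable subst_not_appears)
qed

text \<open>This is modus ponens under a hypothesis \<gamma>; the case \<gamma> = \<emptyset> lets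
  one argue below \<open>Over\<close>.\<close>

lemma derivable_A1:
  assumes "object \<alpha>" "object \<beta>" "object \<gamma>"
  shows "\<^bold>\<turnstile> (((\<gamma> \<^bold>\<Rightarrow> \<alpha>) \<^bold>& (\<gamma> \<^bold>\<Rightarrow> (\<alpha> \<^bold>\<Rightarrow> \<beta>))) \<^bold>\<Rightarrow> (\<gamma> \<^bold>\<Rightarrow> \<beta>))"
proof -
  obtain a where a: "variable a" using fresh_variable[of "{}"] by blast
  obtain b where b: "variable b" "\<not> appears b a" "\<not> appears b \<alpha>"
    using fresh_variable[of "{a, \<alpha>}"] by auto
  obtain c where c: "variable c" "\<not> appears c a" "\<not> appears c b" "\<not> appears c \<alpha>" "\<not> appears c \<beta>"
    using fresh_variable[of "{a, b, \<alpha>, \<beta>}"] by auto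
  have neq: "a \<noteq> b" "a \<noteq> c" "b \<noteq> c" using a b c by (auto simp: appears_variable)
  have "variables [a, b, c]" using a b c neq by (simp add: variables_def)
  from R2[OF R2[OF R2[OF A1[OF this] a assms(1)] b(1) assms(2)] c(1) assms(3)] show ?thesis
    using a b c neq neq[symmetric] by (simp add: subst_variable subst_not_appears)
qed

lemma derivable_Over:
  assumes "object \<alpha>" "object \<beta>" "\<^bold>\<turnstile> (\<alpha> \<^bold>\<Rightarrow> \<beta>)"
  shows "\<^bold>\<turnstile> Over (\<alpha> \<^bold>\<Rightarrow> \<beta>)"
  using R1 assms derivable_A11 by blast

text \<open>A10 joins two formulas only once both are derivable below \<open>Over\<close>. A11
  brings a formula below \<open>Over\<close> when it is an implication, whence the shape of the two
  components.\<close>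

lemma derivable_Fed:
  assumes "object \<alpha>" "object \<beta>" "object \<gamma>" "object \<delta>"
    and "\<^bold>\<turnstile> (\<alpha> \<^bold>\<Rightarrow> \<beta>)" "\<^bold>\<turnstile> (\<gamma> \<^bold>\<Rightarrow> \<delta>)"
  shows "\<^bold>\<turnstile> ((\<alpha> \<^bold>\<Rightarrow> \<beta>) \<^bold>& (\<gamma> \<^bold>\<Rightarrow> \<delta>))"
proof -
  have "object (\<alpha> \<^bold>\<Rightarrow> \<beta>)" "object (\<gamma> \<^bold>\<Rightarrow> \<delta>)"
    using assms by (auto intro: object.intros)
  then show ?thesis
    using R1 derivable_A10 derivable_Over assms by meson
qed

lemma derivable_A14a_Nought:
  assumes "variables [b, x]"
  shows "\<^bold>\<turnstile> (\<^bold>\<emptyset> \<^bold>\<Rightarrow> \<lbrace>x \<^bold>| Mem b x \<^bold>\<emptyset>\<rbrace>)"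
proof -
  have bx: "variable b" "variable x" "b \<noteq> x" using assms by (auto simp: variables_def)
  obtain a where a: "variable a" "\<not> appears a b" "\<not> appears a x"
    using fresh_variable[of "{b, x}"] by auto
  have neq: "a \<noteq> b" "a \<noteq> x" using a bx by (auto simp: appears_variable)
  have "variables [a, b, x]" using a bx neq by (simp add: variables_def)
  from R2[OF A14a[OF this] a(1) object.intros(1)] show ?thesis
    using a bx neq neq[symmetric] by (simp add: cls_def subst_variable bind_variable)
qed

theorem theorem3p13:
  assumes "variable x"
  shows "\<^bold>\<turnstile> (\<lbrace>x \<^bold>| \<^bold>\<bottom>\<rbrace> \<^bold>= \<^bold>\<emptyset>)"
proof -
  \<comment> \<open>The free variable hidden in membership must differ from \<open>x\<close>, or the
    class would bind it.\<close>
  obtain b where b: "variable b" "\<not> appears b x"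
    using fresh_variable[of "{x}"] by auto
  then have bx: "variables [b, x]"
    using assms by (auto simp: variables_def appears_variable)
  let ?M = "Mem b x \<^bold>\<emptyset>"
  have object_M: "object ?M"
    using assms b variable_imp_object by (auto intro!: object.intros)
  have object_Nought: "object \<^bold>\<emptyset>" and object_Bot: "object \<^bold>\<bottom>"
    by (auto intro: object.intros)
  have objects: "object \<lbrace>x \<^bold>| ?M\<rbrace>" "object \<lbrace>x \<^bold>| \<^bold>\<bottom>\<rbrace>"
    using assms object_M object_Bot object_cls by auto
  \<comment> \<open>R3 acts on an implication below some \<gamma> free of \<open>x\<close>;
    \<open>Over\<close> supplies \<gamma> = \<emptyset>.\<close>
  have "\<^bold>\<turnstile> Over (\<^bold>\<bottom> \<^bold>\<Rightarrow> ?M)"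
    using derivable_Over derivable_A9 object_Bot object_M by blast
  then have "\<^bold>\<turnstile> Over (\<lbrace>x \<^bold>| ?M\<rbrace> \<^bold>\<Rightarrow> \<lbrace>x \<^bold>| \<^bold>\<bottom>\<rbrace>)"
    using R3 assms object_Bot object_M object_Nought by simp
  \<comment> \<open>Both components are implications from \<emptyset>, so they can be joined into
    the premise of A1 with \<gamma> = \<emptyset>.\<close>
  then have "\<^bold>\<turnstile> (Over \<lbrace>x \<^bold>| ?M\<rbrace> \<^bold>& Over (\<lbrace>x \<^bold>| ?M\<rbrace> \<^bold>\<Rightarrow> \<lbrace>x \<^bold>| \<^bold>\<bottom>\<rbrace>))"
    using derivable_Fed derivable_A14a_Nought[OF bx] objects object_Nought object.intros(5) by blast
  then have "\<^bold>\<turnstile> Over \<lbrace>x \<^bold>| \<^bold>\<bottom>\<rbrace>"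
    using R1 derivable_A1 objects object_Nought by blast
  then show ?thesis
    using derivable_Fed derivable_A8 objects(2) object_Nought by blast
qed

end
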